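(* (Undefinability.) There exists an $\mathit{MSO}[<]$ formula $\Psi(X,Y)$ such that: (1) there is no $\mathit{MSO}[<]$-definable C-operator $F$ such that $\mathit{FVsig}\models \forall X.\ \Psi(X,F(X))$; and (2) there is a C-operator $F$ such that $\mathit{FVsig}\models \forall X.\ \Psi(X,F(X))$.
   Context: A (finitely variable) boolean signal is a function $f:\mathbb{R}^{\geq 0}\to\{0,1\}$ for which there is an unbounded strictly increasing sequence $0=\tau_0<\tau_1<\cdots$ of reals such that $f$ is constant on every open interval $(\tau_i,\tau_{i+1})$; a signal is identified with the subset of $\mathbb{R}^{\geq 0}$ where it is $1$. $\mathit{MSO}[<]$ is monadic second-order logic with atomic formulas $t<v$ and $X(t)$, boolean connectives, and first- and second-order quantifiers. $\mathit{FVsig}$ is the structure in which first-order variables range over $\mathbb{R}^{\geq 0}$ with its usual order and monadic second-order variables range over the finitely variable boolean signals. An operator is a function $F$ from signals to signals. $F$ is a C-operator (causal) if for every $t\geq 0$ and all signals $X_1,X_2$ that agree on $[0,t]$, $F(X_1)(t)=F(X_2)(t)$. An operator $F$ is $\mathit{MSO}[<]$-definable if there is an $\mathit{MSO}[<]$ formula $U(X,Y)$ such that for all signals $X,Y$: $\mathit{FVsig}\models U(X,Y)$ iff $Y=F(X)$. *)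

theory Defs
  imports "HOL-Analysis.Analysis"
begin

text \<open>A boolean signal on the nonnegative reals is represented by the subset of \<open>{0..}\<close> on which
  it is 1, so that equality of signals is equality of sets.\<close>

definition FVsig :: "real set set" where
  "FVsig = {X. X \<subseteq> {0..} \<and>
     (\<exists>\<tau> :: nat \<Rightarrow> real. \<tau> 0 = 0 \<and> strict_mono \<tau> \<and> \<not> bdd_above (range \<tau>) \<and>
        (\<forall>i. (\<lambda>t. t \<in> X) constant_on {\<tau> i<..<\<tau> (Suc i)}))}"

text \<open>First-order and monadic second-order variables are two separate sorts, each named by
  natural numbers.\<close>

datatype mso =
    Less nat nat
  | App nat nat  \<comment> \<open>\<open>App X t\<close> is the atom \<open>X(t)\<close>\<close>
  | Neg mso
  | Conj mso mso
  | Disj mso mso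
  | Imp mso mso
  | Ex1 nat mso
  | All1 nat mso
  | Ex2 nat mso
  | All2 nat mso

fun free1 :: "mso \<Rightarrow> nat set" where
  "free1 (Less t v) = {t, v}"
| "free1 (App X t) = {t}"
| "free1 (Neg \<phi>) = free1 \<phi>"
| "free1 (Conj \<phi> \<psi>) = free1 \<phi> \<union> free1 \<psi>"
| "free1 (Disj \<phi> \<psi>) = free1 \<phi> \<union> free1 \<psi>"
| "free1 (Imp \<phi> \<psi>) = free1 \<phi> \<union> free1 \<psi>"
| "free1 (Ex1 t \<phi>) = free1 \<phi> - {t}"
| "free1 (All1 t \<phi>) = free1 \<phi> - {t}"
| "free1 (Ex2 X \<phi>) = free1 \<phi>"
| "free1 (All2 X \<phi>) = free1 \<phi>"

fun free2 :: "mso \<Rightarrow> nat set" where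
  "free2 (Less t v) = {}"
| "free2 (App X t) = {X}"
| "free2 (Neg \<phi>) = free2 \<phi>"
| "free2 (Conj \<phi> \<psi>) = free2 \<phi> \<union> free2 \<psi>"
| "free2 (Disj \<phi> \<psi>) = free2 \<phi> \<union> free2 \<psi>"
| "free2 (Imp \<phi> \<psi>) = free2 \<phi> \<union> free2 \<psi>"
| "free2 (Ex1 t \<phi>) = free2 \<phi>"
| "free2 (All1 t \<phi>) = free2 \<phi>"
| "free2 (Ex2 X \<phi>) = free2 \<phi> - {X}"
| "free2 (All2 X \<phi>) = free2 \<phi> - {X}"

fun sat :: "(nat \<Rightarrow> real) \<Rightarrow> (nat \<Rightarrow> real set) \<Rightarrow> mso \<Rightarrow> bool" where
  "sat a b (Less t v) \<longleftrightarrow> a t < a v"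
| "sat a b (App X t) \<longleftrightarrow> a t \<in> b X"
| "sat a b (Neg \<phi>) \<longleftrightarrow> \<not> sat a b \<phi>"
| "sat a b (Conj \<phi> \<psi>) \<longleftrightarrow> sat a b \<phi> \<and> sat a b \<psi>"
| "sat a b (Disj \<phi> \<psi>) \<longleftrightarrow> sat a b \<phi> \<or> sat a b \<psi>"
| "sat a b (Imp \<phi> \<psi>) \<longleftrightarrow> (sat a b \<phi> \<longrightarrow> sat a b \<psi>)"
| "sat a b (Ex1 t \<phi>) \<longleftrightarrow> (\<exists>r\<in>{0..}. sat (a(t := r)) b \<phi>)"
| "sat a b (All1 t \<phi>) \<longleftrightarrow> (\<forall>r\<in>{0..}. sat (a(t := r)) b \<phi>)"
| "sat a b (Ex2 X \<phi>) \<longleftrightarrow> (\<exists>S\<in>FVsig. sat a (b(X := S)) \<phi>)"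
| "sat a b (All2 X \<phi>) \<longleftrightarrow> (\<forall>S\<in>FVsig. sat a (b(X := S)) \<phi>)"

text \<open>A formula \<open>\<phi>(X,Y)\<close> uses the second-order variables 0 and 1 for \<open>X\<close> and \<open>Y\<close> and has no
  other free variables, so the values assigned to the remaining variables below are immaterial.\<close>

definition formula_XY :: "mso \<Rightarrow> bool" where
  "formula_XY \<phi> \<longleftrightarrow> free1 \<phi> = {} \<and> free2 \<phi> \<subseteq> {0, 1}"

definition sat_XY :: "mso \<Rightarrow> real set \<Rightarrow> real set \<Rightarrow> bool" where
  "sat_XY \<phi> X Y \<longleftrightarrow> sat (\<lambda>_. 0) ((\<lambda>_. {})(0 := X, 1 := Y)) \<phi>"

text \<open>Only the values of \<open>F\<close> on signals matter.\<close>

definition signal_operator :: "(real set \<Rightarrow> real set) \<Rightarrow> bool" where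
  "signal_operator F \<longleftrightarrow> (\<forall>X\<in>FVsig. F X \<in> FVsig)"

definition C_operator :: "(real set \<Rightarrow> real set) \<Rightarrow> bool" where
  "C_operator F \<longleftrightarrow> signal_operator F \<and>
     (\<forall>t\<ge>0. \<forall>X1\<in>FVsig. \<forall>X2\<in>FVsig.
        (\<forall>s\<in>{0..t}. s \<in> X1 \<longleftrightarrow> s \<in> X2) \<longrightarrow> (t \<in> F X1 \<longleftrightarrow> t \<in> F X2))"

definition MSO_definable :: "(real set \<Rightarrow> real set) \<Rightarrow> bool" where
  "MSO_definable F \<longleftrightarrow>
     (\<exists>U. formula_XY U \<and> (\<forall>X\<in>FVsig. \<forall>Y\<in>FVsig. sat_XY U X Y \<longleftrightarrow> Y = F X))"

end

theory Submission
  imports Defs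
begin

text \<open>
  The formula says that \<open>Y\<close> takes both values at positive times. A constant operator is causal, so
  the constant operator with value \<open>[1,\<infinity>)\<close> satisfies it. Truth in \<open>FVsig\<close> is invariant under order
  automorphisms of the time axis, so a definable operator commutes with them. It therefore sends the
  invariant signal \<open>\<emptyset>\<close> to an invariant signal, and this signal is constant on the positive times
  because dilations act transitively on them.
\<close>

lemma FVsigI:
  fixes \<tau> :: "nat \<Rightarrow> real"
  assumes "X \<subseteq> {0..}" "\<tau> 0 = 0" "strict_mono \<tau>" "\<not> bdd_above (range \<tau>)"
    and "\<And>i. (\<lambda>t. t \<in> X) constant_on {\<tau> i<..<\<tau> (Suc i)}"
  shows "X \<in> FVsig"
  unfolding FVsig_def using assms by (auto intro!: exI[of _ \<tau>])

text \<open>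
  Automorphisms are maps of the whole real line: every order automorphism of \<open>{0..}\<close> extends to one
  fixing 0, and injectivity of the extension makes its action on sets well behaved.
\<close>

locale time_automorphism =
  fixes h :: "real \<Rightarrow> real"
  assumes strict_mono: "strict_mono h"
    and surj: "surj h"
    and fixes_0: "h 0 = 0"
begin

lemma inj: "inj h"
  using strict_mono by (rule strict_mono_imp_inj_on)

lemma time_automorphism_inv: "time_automorphism (inv h)"
proof
  show "strict_mono (inv h)"
    using strict_mono surj inv_f_f[OF inj] by (rule strict_mono_inv)
  show "surj (inv h)"
    using inj by (rule inj_imp_surj_inv)
  show "inv h 0 = 0"
    using inv_f_f[OF inj, of 0] by (simp add: fixes_0)
qed

lemma nonneg_iff: "0 \<le> h t \<longleftrightarrow> 0 \<le> t"
  using strict_mono_less_eq[OF strict_mono, of 0 t] by (simp add: fixes_0)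

lemma image_nonneg: "h ` {0..} = {0..}"
proof
  show "{0..} \<subseteq> h ` {0..}"
  proof
    fix t :: real
    assume "t \<in> {0..}"
    moreover obtain s where "t = h s"
      using surj by (rule surjE)
    ultimately show "t \<in> h ` {0..}"
      by (simp add: nonneg_iff)
  qed
qed (auto simp: nonneg_iff)

lemma constant_on_image:
  assumes "(\<lambda>t. t \<in> X) constant_on {a<..<b}"
  shows "(\<lambda>t. t \<in> h ` X) constant_on {h a<..<h b}"
proof -
  obtain v where v: "\<And>s. s \<in> {a<..<b} \<Longrightarrow> (s \<in> X) = v"
    using assms unfolding constant_on_def by blast
  show ?thesis
    unfolding constant_on_def
  proof (intro exI ballI)
    fix t :: real
    assume "t \<in> {h a<..<h b}"
    moreover obtain s where s: "t = h s"
      using surj by (rule surjE)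
    ultimately have "s \<in> {a<..<b}"
      by (simp add: strict_mono_less[OF strict_mono])
    then show "(t \<in> h ` X) = v"
      unfolding s inj_image_mem_iff[OF inj] by (rule v)
  qed
qed

lemma bdd_above_image_iff: "bdd_above (h ` A) \<longleftrightarrow> bdd_above A"
proof
  have "mono (inv h)"
    using time_automorphism.strict_mono[OF time_automorphism_inv] by (rule strict_mono_mono)
  moreover assume "bdd_above (h ` A)"
  ultimately have "bdd_above (inv h ` h ` A)"
    by (rule bdd_above_image_mono)
  then show "bdd_above A"
    by (simp add: image_inv_f_f[OF inj])
qed (rule bdd_above_image_mono[OF strict_mono_mono[OF strict_mono]])

lemma image_in_FVsig:
  assumes "X \<in> FVsig"
  shows "h ` X \<in> FVsig"
proof -
  obtain \<tau> :: "nat \<Rightarrow> real" where X: "X \<subseteq> {0..}"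
      and \<tau>: "\<tau> 0 = 0" "strict_mono \<tau>" "\<not> bdd_above (range \<tau>)"
      and const: "\<And>i. (\<lambda>t. t \<in> X) constant_on {\<tau> i<..<\<tau> (Suc i)}"
    using assms by (auto simp: FVsig_def)
  show ?thesis
  proof (rule FVsigI)
    show "h ` X \<subseteq> {0..}"
      using image_mono[OF X, of h] by (simp only: image_nonneg)
    show "(h \<circ> \<tau>) 0 = 0"
      by (simp add: \<tau>(1) fixes_0)
    show "strict_mono (h \<circ> \<tau>)"
      using strict_mono \<tau>(2) by (rule strict_mono_o)
    show "\<not> bdd_above (range (h \<circ> \<tau>))"
      using \<tau>(3) bdd_above_image_iff[of "range \<tau>"] by (simp add: image_image comp_def)
    show "(\<lambda>t. t \<in> h ` X) constant_on {(h \<circ> \<tau>) i<..<(h \<circ> \<tau>) (Suc i)}" for i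
      using constant_on_image[OF const] by simp
  qed
qed

lemma image_FVsig: "(`) h ` FVsig = FVsig"
proof
  show "(`) h ` FVsig \<subseteq> FVsig"
    using image_in_FVsig by blast
  show "FVsig \<subseteq> (`) h ` FVsig"
  proof
    fix X :: "real set"
    assume "X \<in> FVsig"
    then have "inv h ` X \<in> FVsig"
      by (rule time_automorphism.image_in_FVsig[OF time_automorphism_inv])
    moreover have "X = h ` inv h ` X"
      by (simp add: image_f_inv_f[OF surj])
    ultimately show "X \<in> (`) h ` FVsig"
      by (rule rev_image_eqI)
  qed
qed

lemma sat_image: "sat (h \<circ> a) ((`) h \<circ> b) \<phi> \<longleftrightarrow> sat a b \<phi>"
proof (induction \<phi> arbitrary: a b)
  case (Less t v)
  show ?case
    by (simp add: strict_mono_less[OF strict_mono])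
next
  case (App X t)
  show ?case
    by (simp add: inj_image_mem_iff[OF inj])
next
  case (Ex1 t \<phi>)
  have "sat (h \<circ> a) ((`) h \<circ> b) (Ex1 t \<phi>) \<longleftrightarrow>
      (\<exists>r\<in>h ` {0..}. sat ((h \<circ> a)(t := r)) ((`) h \<circ> b) \<phi>)"
    by (simp only: sat.simps image_nonneg)
  also have "\<dots> \<longleftrightarrow> sat a b (Ex1 t \<phi>)"
    by (simp only: sat.simps bex_simps Ex1.IH flip: fun_upd_comp)
  finally show ?case .
next
  case (All1 t \<phi>)
  have "sat (h \<circ> a) ((`) h \<circ> b) (All1 t \<phi>) \<longleftrightarrow>
      (\<forall>r\<in>h ` {0..}. sat ((h \<circ> a)(t := r)) ((`) h \<circ> b) \<phi>)"
    by (simp only: sat.simps image_nonneg)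
  also have "\<dots> \<longleftrightarrow> sat a b (All1 t \<phi>)"
    by (simp only: sat.simps ball_simps All1.IH flip: fun_upd_comp)
  finally show ?case .
next
  case (Ex2 X \<phi>)
  have "sat (h \<circ> a) ((`) h \<circ> b) (Ex2 X \<phi>) \<longleftrightarrow>
      (\<exists>S\<in>(`) h ` FVsig. sat (h \<circ> a) (((`) h \<circ> b)(X := S)) \<phi>)"
    by (simp only: sat.simps image_FVsig)
  also have "\<dots> \<longleftrightarrow> sat a b (Ex2 X \<phi>)"
    by (simp only: sat.simps bex_simps Ex2.IH flip: fun_upd_comp)
  finally show ?case .
next
  case (All2 X \<phi>)
  have "sat (h \<circ> a) ((`) h \<circ> b) (All2 X \<phi>) \<longleftrightarrow>
      (\<forall>S\<in>(`) h ` FVsig. sat (h \<circ> a) (((`) h \<circ> b)(X := S)) \<phi>)"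
    by (simp only: sat.simps image_FVsig)
  also have "\<dots> \<longleftrightarrow> sat a b (All2 X \<phi>)"
    by (simp only: sat.simps ball_simps All2.IH flip: fun_upd_comp)
  finally show ?case .
qed simp_all

lemma sat_XY_image: "sat_XY \<phi> (h ` X) (h ` Y) \<longleftrightarrow> sat_XY \<phi> X Y"
proof -
  have "h \<circ> (\<lambda>_. 0) = (\<lambda>_::nat. 0)"
    by (simp add: comp_def fixes_0)
  moreover have "(`) h \<circ> (\<lambda>_. {})(0 := X, 1 := Y) = (\<lambda>_::nat. {})(0 := h ` X, 1 := h ` Y)"
    by (auto simp: fun_eq_iff)
  ultimately show ?thesis
    using sat_image[of "\<lambda>_. 0" "(\<lambda>_. {})(0 := X, 1 := Y)" \<phi>] by (simp only: sat_XY_def)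
qed

lemma MSO_definable_commutes:
  assumes "MSO_definable F" "signal_operator F" and X: "X \<in> FVsig"
  shows "F (h ` X) = h ` F X"
proof -
  obtain U where U: "\<And>X Y. X \<in> FVsig \<Longrightarrow> Y \<in> FVsig \<Longrightarrow> sat_XY U X Y \<longleftrightarrow> Y = F X"
    using assms(1) unfolding MSO_definable_def by blast
  have FX: "F X \<in> FVsig"
    using assms(2) X by (simp add: signal_operator_def)
  have "sat_XY U (h ` X) (h ` F X)"
    using U[OF X FX] by (simp add: sat_XY_image)
  then show ?thesis
    using U[OF image_in_FVsig[OF X] image_in_FVsig[OF FX]] by simp
qed

end

lemma time_automorphism_dilation:
  assumes "c > 0"
  shows "time_automorphism ((*) c)"
proof
  show "strict_mono ((*) c)"
    using assms by (simp add: strict_mono_def)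
  show "surj ((*) c)"
    using assms by (intro surjI[of _ "\<lambda>t. t / c"]) simp
qed simp

lemma FVsig_constant_on_grid:
  fixes d :: real
  assumes "d > 0" "X \<subseteq> {0..}"
    and "\<And>i::nat. (\<lambda>t. t \<in> X) constant_on {d * real i<..<d * real (Suc i)}"
  shows "X \<in> FVsig"
proof (rule FVsigI[where \<tau> = "\<lambda>i. d * real i"])
  interpret time_automorphism "(*) d"
    using assms(1) by (rule time_automorphism_dilation)
  show "strict_mono (\<lambda>i. d * real i)"
    using assms(1) by (simp add: strict_mono_def)
  have "\<not> bdd_above (range real)"
    by (auto simp: bdd_above_def not_le intro: reals_Archimedean2)
  then show "\<not> bdd_above (range (\<lambda>i. d * real i))"
    using bdd_above_image_iff[of "range real"] by (simp add: image_image)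
qed (use assms in simp_all)

lemma empty_in_FVsig: "{} \<in> FVsig"
  by (rule FVsig_constant_on_grid[of 1]) (auto simp: constant_on_def)

lemma atLeast_in_FVsig:
  assumes "d > 0"
  shows "{d..} \<in> FVsig"
proof (rule FVsig_constant_on_grid[OF assms])
  fix i :: nat
  have "t \<in> {d..} \<longleftrightarrow> i \<noteq> 0" if t: "t \<in> {d * real i<..<d * real (Suc i)}" for t
  proof (cases "i = 0")
    case False
    then have "d * 1 \<le> d * real i"
      using assms by (intro mult_left_mono) auto
    with t False show ?thesis
      by simp
  qed (use t in simp)
  then show "(\<lambda>t. t \<in> {d..}) constant_on {d * real i<..<d * real (Suc i)}"
    unfolding constant_on_def by blast
qed (use assms in auto)

lemma MSO_definable_empty_mem_iff:
  assumes "MSO_definable F" "signal_operator F" and "p > 0" "q > 0"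
  shows "p \<in> F {} \<longleftrightarrow> q \<in> F {}"
proof -
  interpret time_automorphism "(*) (q / p)"
    using assms(3,4) by (intro time_automorphism_dilation) simp
  have "q / p * p \<in> (*) (q / p) ` F {} \<longleftrightarrow> p \<in> F {}"
    by (rule inj_image_mem_iff[OF inj])
  moreover have "(*) (q / p) ` F {} = F {}"
    using MSO_definable_commutes[OF assms(1,2) empty_in_FVsig] by simp
  ultimately show ?thesis
    using assms(3) by simp
qed

lemma C_operator_const:
  assumes "Y \<in> FVsig"
  shows "C_operator (\<lambda>_. Y)"
  using assms by (simp add: C_operator_def signal_operator_def)

text \<open>The variable 0 only serves to say that the times named 1 and 2 are positive.\<close>

definition both_values_at_positive_times :: mso where
  "both_values_at_positive_times =
    Ex1 0 (Ex1 1 (Ex1 2 (Conj (Conj (Less 0 1) (Less 0 2)) (Conj (App 1 1) (Neg (App 1 2))))))"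

lemma formula_XY_both_values_at_positive_times: "formula_XY both_values_at_positive_times"
  by (auto simp: formula_XY_def both_values_at_positive_times_def)

lemma sat_XY_both_values_at_positive_times:
  "sat_XY both_values_at_positive_times X Y \<longleftrightarrow> (\<exists>p>0. \<exists>q>0. p \<in> Y \<and> q \<notin> Y)"
proof -
  have "sat_XY both_values_at_positive_times X Y \<longleftrightarrow>
      (\<exists>r\<ge>0. \<exists>p\<ge>0. \<exists>q\<ge>0. r < p \<and> r < q \<and> p \<in> Y \<and> q \<notin> Y)"
    by (auto simp: sat_XY_def both_values_at_positive_times_def)
  also have "\<dots> \<longleftrightarrow> (\<exists>p>0. \<exists>q>0. p \<in> Y \<and> q \<notin> Y)"
    by (meson le_less_trans less_imp_le order_refl)
  finally show ?thesis .
qed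

lemma MSO_definable_not_sat_both_values_at_positive_times:
  assumes "MSO_definable F" "signal_operator F"
  shows "\<not> sat_XY both_values_at_positive_times {} (F {})"
  using MSO_definable_empty_mem_iff[OF assms]
  unfolding sat_XY_both_values_at_positive_times by blast

lemma sat_XY_both_values_at_positive_times_atLeast:
  assumes "d > 0"
  shows "sat_XY both_values_at_positive_times X {d..}"
proof -
  have "d \<in> {d..}" and "d / 2 > 0" and "d / 2 \<notin> {d..}"
    using assms by simp_all
  then show ?thesis
    using assms unfolding sat_XY_both_values_at_positive_times by blast
qed

theorem theorem1p4:
  shows "\<exists>\<Psi>. formula_XY \<Psi> \<and>
    \<not> (\<exists>F. C_operator F \<and> MSO_definable F \<and> (\<forall>X\<in>FVsig. sat_XY \<Psi> X (F X))) \<and>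
    (\<exists>F. C_operator F \<and> (\<forall>X\<in>FVsig. sat_XY \<Psi> X (F X)))"
proof (intro exI conjI notI)
  show "formula_XY both_values_at_positive_times"
    by (rule formula_XY_both_values_at_positive_times)
  show False
    if "\<exists>F. C_operator F \<and> MSO_definable F \<and>
      (\<forall>X\<in>FVsig. sat_XY both_values_at_positive_times X (F X))"
    using that empty_in_FVsig MSO_definable_not_sat_both_values_at_positive_times
    unfolding C_operator_def by blast
  show "C_operator (\<lambda>_. {1..})"
    by (intro C_operator_const atLeast_in_FVsig zero_less_one)
  show "\<forall>X\<in>FVsig. sat_XY both_values_at_positive_times X {1..}"
    by (intro ballI sat_XY_both_values_at_positive_times_atLeast zero_less_one)
qed

end
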